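(* Let $p$ be an integer and let $n_\kappa = p+2 \geq 2$. On the reference element $[-1,1]$ with $n_\kappa$ Legendre-Gauss-Lobatto nodes, consider the derivative-based dissipation operator $$M_\kappa^{D} = \left(D_{\xi,\kappa}^{s}\right)^T H_\kappa A_\kappa D_{\xi,\kappa}^{s}, \qquad s = p+1,$$ and the projection-based dissipation operator $$M_\kappa^{P} = P_\kappa^T H_\kappa A_\kappa P_\kappa .$$ Then $M_\kappa^{D} = \alpha\, M_\kappa^{P}$ for some constant $\alpha > 0$.
   Context: Notation. $\xi_1<\dots<\xi_{n_\kappa}$ are the Legendre-Gauss-Lobatto (LGL) nodes on $[-1,1]$ (endpoints included). $H_\kappa\in\mathbb{R}^{n_\kappa\times n_\kappa}$ is the diagonal matrix with the corresponding LGL quadrature weights (all positive) on its diagonal; the quadrature is exact for polynomials of degree $2n_\kappa-3$. $\mathbb{P}_p[-1,1]$ is the space of polynomials of degree at most $p$. First-derivative operator: $D_{\xi,\kappa} = H_\kappa^{-1}Q_{\xi,\kappa}$ is a degree $p$ diagonal-norm summation-by-parts (SBP) operator on the LGL nodes. That is, $D_{\xi,\kappa}$ exactly differentiates polynomials of degree at most $p$ at the nodes, and $Q_{\xi,\kappa}+Q_{\xi,\kappa}^T=\mathrm{diag}(-1,0,\dots,0,1)$. Operator $D_{\xi,\kappa}^s$, with $s=p+1$: it is either the product of $s$ copies of $D_{\xi,\kappa}$ or a direct discretization of $\partial^s/\partial\xi^s$ at the nodes, i.e. a non-zero $n_\kappa\times n_\kappa$ matrix. In either case $D_{\xi,\kappa}^s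 \vec{p}=0$ whenever $\vec p$ is the vector of nodal values of a polynomial in $\mathbb{P}_p[-1,1]$. Scaling matrix: $A_\kappa = \mathrm{diag}(\mathcal{A}(\xi_1),\dots,\mathcal{A}(\xi_{n_\kappa}))$ for a function $\mathcal{A}(\xi)>0$ on $[-1,1]$. Projection: let $\{\mathcal{L}_j\}_{j=0}^{p}$ be the Legendre polynomials of degrees $0,\dots,p$, normalized to have unit $L^2[-1,1]$ norm. Let $L\in\mathbb{R}^{n_\kappa\times(p+1)}$ be the matrix of their nodal values, $L_{ij}=\mathcal{L}_j(\xi_i)$ (columns indexed by $j=0,\dots,p$). Then $L^T H_\kappa L = I$, and $P_\kappa = I - L L^T H_\kappa$. *)

theory Defs
  imports
    "HOL-Analysis.Henstock_Kurzweil_Integration"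
    "HOL-Computational_Algebra.Polynomial"
    "Jordan_Normal_Form.Matrix"
begin

text \<open>Vectors and matrices are those of Jordan_Normal_Form, so the dimension \<open>n\<close> is an ordinary
  natural number and indices run from \<open>0\<close> to \<open>n - 1\<close>.\<close>

(* Rodrigues' formula *)
definition legendre :: "nat \<Rightarrow> real poly" where
  "legendre m = Polynomial.smult (1 / (2 ^ m * fact m)) ((pderiv ^^ m) ([:-1, 0, 1:] ^ m))"

(* unit norm in L2[-1,1] *)
definition legendre_normalized :: "nat \<Rightarrow> real poly" where
  "legendre_normalized m =
     Polynomial.smult (1 / sqrt (integral {-1..1} (\<lambda>x. (poly (legendre m) x)\<^sup>2))) (legendre m)"

(* The endpoints together with the zeros of the derivative of the Legendre polynomial of degree n - 1,
   in increasing order; intended for n \<ge> 2. *)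
definition lgl_nodes :: "nat \<Rightarrow> real list" where
  "lgl_nodes n =
     sorted_list_of_set ({-1, 1} \<union> {x \<in> {-1<..<1}. poly (pderiv (legendre (n - 1))) x = 0})"

abbreviation lgl_node :: "nat \<Rightarrow> nat \<Rightarrow> real" where
  "lgl_node n i \<equiv> lgl_nodes n ! i"

definition lagrange_basis :: "nat \<Rightarrow> nat \<Rightarrow> real poly" where
  "lagrange_basis n i =
     (\<Prod>j\<in>{..<n} - {i}.
        Polynomial.smult (1 / (lgl_node n i - lgl_node n j)) [:- lgl_node n j, 1:])"

(* weights of the interpolatory quadrature rule on the LGL nodes *)
definition lgl_weight :: "nat \<Rightarrow> nat \<Rightarrow> real" where
  "lgl_weight n i = integral {-1..1} (poly (lagrange_basis n i))"

definition H_mat :: "nat \<Rightarrow> real mat" where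
  "H_mat n = mat_diag n (lgl_weight n)"

definition A_mat :: "nat \<Rightarrow> (real \<Rightarrow> real) \<Rightarrow> real mat" where
  "A_mat n \<A> = mat_diag n (\<lambda>i. \<A> (lgl_node n i))"

definition nodal_values :: "nat \<Rightarrow> real poly \<Rightarrow> real vec" where
  "nodal_values n q = vec n (\<lambda>i. poly q (lgl_node n i))"

(* mat_diag n (\<lambda>i. 1 / lgl_weight n i) is the inverse of H_mat n, as the LGL weights are positive. *)
definition sbp_operator :: "nat \<Rightarrow> nat \<Rightarrow> real mat \<Rightarrow> bool" where
  "sbp_operator n p D \<longleftrightarrow>
     (\<exists>Q \<in> carrier_mat n n.
        D = mat_diag n (\<lambda>i. 1 / lgl_weight n i) * Q \<and>
        Q + transpose_mat Q =
          mat_diag n (\<lambda>i. if i = 0 then -1 else if i = n - 1 then 1 else 0)) \<and>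
     (\<forall>q. degree q \<le> p \<longrightarrow> D *\<^sub>v nodal_values n q = nodal_values n (pderiv q))"

(* The second disjunct describes a direct discretization of the s-th derivative. *)
definition sth_derivative_operator :: "nat \<Rightarrow> nat \<Rightarrow> real mat \<Rightarrow> nat \<Rightarrow> real mat \<Rightarrow> bool" where
  "sth_derivative_operator n p D s Ds \<longleftrightarrow>
     Ds = D ^\<^sub>m s \<or>
     (Ds \<in> carrier_mat n n \<and> Ds \<noteq> 0\<^sub>m n n \<and>
      (\<forall>q. degree q \<le> p \<longrightarrow> Ds *\<^sub>v nodal_values n q = 0\<^sub>v n))"

definition L_mat :: "nat \<Rightarrow> nat \<Rightarrow> real mat" where
  "L_mat n p = mat n (p + 1) (\<lambda>(i, j). poly (legendre_normalized j) (lgl_node n i))"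

definition P_mat :: "nat \<Rightarrow> nat \<Rightarrow> real mat" where
  "P_mat n p = 1\<^sub>m n - L_mat n p * transpose_mat (L_mat n p) * H_mat n"

definition derivative_dissipation :: "nat \<Rightarrow> (real \<Rightarrow> real) \<Rightarrow> real mat \<Rightarrow> real mat" where
  "derivative_dissipation n \<A> Ds = transpose_mat Ds * H_mat n * A_mat n \<A> * Ds"

definition projection_dissipation :: "nat \<Rightarrow> nat \<Rightarrow> (real \<Rightarrow> real) \<Rightarrow> real mat" where
  "projection_dissipation n p \<A> = transpose_mat (P_mat n p) * H_mat n * A_mat n \<A> * P_mat n p"

end

(* The nodal vectors of polynomials of degree at most p form a hyperplane in R^n, n = p + 2, and both
   D^s and P annihilate it. Hence each of them is an outer product of some nonzero vector u with one
   and the same row vector c (the coefficients of x^(p+1) in the Lagrange basis), and its dissipation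
   matrix is (u^T H A u) c c^T with u^T H A u > 0, the quadrature weights being positive.
   P is nonzero because it fixes the nodal vector of the Legendre polynomial of degree p + 1. A power
   of D of order p + 1 is nonzero because, by summation by parts, the kernel of D consists of the
   constants only, so that by induction the kernel of D^k consists of polynomials of degree below k. *)

theory Submission
  imports Defs "HOL-Analysis.Equivalence_Lebesgue_Henstock_Integration"
begin

section \<open>Integrals and derivatives of real polynomials and Legendre polynomials\<close>

lemma poly_integrable_on: "poly f integrable_on {a..b}" for f :: "real poly" and a b :: real
  by (intro integrable_continuous_real continuous_intros)

lemma integral_poly_pderiv:
  fixes f :: "real poly" and a b :: real
  assumes "a \<le> b"
  shows "integral {a..b} (poly (pderiv f)) = poly f b - poly f a"
proof (rule integral_unique, rule fundamental_theorem_of_calculus[OF assms])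
  fix x assume "x \<in> {a..b}"
  show "(poly f has_vector_derivative poly (pderiv f) x) (at x within {a..b})"
    by (metis has_field_derivative_at_within has_real_derivative_iff_has_vector_derivative poly_DERIV)
qed

lemma integral_poly_add:
  "integral {a..b} (poly (f + g)) = integral {a..b} (poly f) + integral {a..b} (poly g)"
  for f g :: "real poly" and a b :: real
  unfolding poly_add[abs_def] by (intro Henstock_Kurzweil_Integration.integral_add poly_integrable_on)

lemma integral_poly_smult:
  "integral {a..b} (poly (Polynomial.smult c f)) = c * integral {a..b} (poly f)"
  for f :: "real poly" and a b c :: real
  unfolding poly_smult[abs_def] by simp

lemma integral_poly_0 [simp]: "integral {a..b} (poly 0) = 0" for a b :: real
  using integral_poly_smult[of a b 0 0] by simp

lemma integral_poly_sum:
  "finite S \<Longrightarrow> integral {a..b} (poly (\<Sum>i\<in>S. f i)) = (\<Sum>i\<in>S. integral {a..b} (poly (f i)))"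
  for f :: "'i \<Rightarrow> real poly" and a b :: real
  unfolding poly_sum[abs_def] by (intro Henstock_Kurzweil_Integration.integral_sum poly_integrable_on)

text \<open>A continuous nonnegative function with integral zero vanishes on the whole interval,
  which would give \<open>f\<close> infinitely many roots.\<close>

lemma integral_poly_pos:
  fixes f :: "real poly" and a b :: real
  assumes "a < b" and "\<And>x. x \<in> {a..b} \<Longrightarrow> poly f x \<ge> 0" and "f \<noteq> 0"
  shows "integral {a..b} (poly f) > 0"
proof (rule ccontr)
  assume "\<not> ?thesis"
  moreover have "integral {a..b} (poly f) \<ge> 0"
    using assms(2) by (intro Henstock_Kurzweil_Integration.integral_nonneg poly_integrable_on)
  ultimately have "integral {a..b} (poly f) = 0"
    by simp
  then have "poly f x = 0" if "x \<in> {a..b}" for x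
    using that assms(1,2)
    by (subst (asm) integral_eq_0_iff) (auto intro!: continuous_intros)
  then have "{a..b} \<subseteq> {x. poly f x = 0}"
    by auto
  then have "finite {a..b}"
    using poly_roots_finite[OF assms(3)] finite_subset by blast
  then show False
    using assms(1) by (simp add: infinite_Icc)
qed

text \<open>The clause for \<open>q = 0\<close> is stated separately because the degree bound alone
  would still admit degree 1; the kernel induction for powers of \<open>D\<close> needs degree 0 in
  its first step.\<close>

lemma ex_poly_antiderivative:
  fixes q :: "real poly"
  obtains r where "pderiv r = q" and "degree r \<le> Suc (degree q)" and "q = 0 \<Longrightarrow> r = 0"
proof
  define r where "r = (\<Sum>i\<le>degree q. Polynomial.monom (Polynomial.coeff q i / real (Suc i)) (Suc i))"
  have "pderiv r = (\<Sum>i\<le>degree q. pderiv (Polynomial.monom (Polynomial.coeff q i / real (Suc i)) (Suc i)))"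
    unfolding r_def using higher_pderiv_sum[of 1] by simp
  also have "\<dots> = (\<Sum>i\<le>degree q. Polynomial.monom (Polynomial.coeff q i) i)"
    by (simp add: pderiv_monom del: of_nat_Suc)
  also have "\<dots> = q"
    by (rule poly_as_sum_of_monoms)
  finally show "pderiv r = q" .
  show "degree r \<le> Suc (degree q)"
    unfolding r_def
    by (intro degree_sum_le) (auto intro: order_trans[OF degree_monom_le])
  show "r = 0" if "q = 0"
    using that by (simp add: r_def)
qed

text \<open>Rolle's theorem with counting. Removing the largest zero \<open>M\<close> leaves zeros
  up to the next largest one, \<open>c\<close>; the induction hypothesis on \<open>{a..c}\<close>
  (hence the generalized \<open>b\<close>) gives critical points below \<open>c\<close>, and the
  mean value theorem adds one between \<open>c\<close> and \<open>M\<close>.\<close>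

lemma poly_rolle_card:
  fixes f :: "real poly" and a b :: real
  assumes "finite S" "card S = Suc k" "S \<subseteq> {a..b}" "\<And>x. x \<in> S \<Longrightarrow> poly f x = 0"
  shows "\<exists>T \<subseteq> {a<..<b}. finite T \<and> card T = k \<and> (\<forall>x\<in>T. poly (pderiv f) x = 0)"
  using assms
proof (induction k arbitrary: S b)
  case 0
  then show ?case by (intro exI[of _ "{}"]) auto
next
  case (Suc k)
  define M where "M = Max S"
  define S' where "S' = S - {M}"
  have "S \<noteq> {}"
    using Suc.prems by auto
  then have M: "M \<in> S"
    unfolding M_def using Suc.prems(1) by (intro Max_in)
  have S': "finite S'" "card S' = Suc k"
    using Suc.prems M by (auto simp: S'_def)
  define c where "c = Max S'"
  have "S' \<noteq> {}"
    using S' by auto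
  then have c: "c \<in> S'"
    unfolding c_def using S' by (intro Max_in)
  have "c < M"
    using c Suc.prems(1) Max_ge[of S c] by (simp add: S'_def M_def order.not_eq_order_implies_strict)
  have "x \<in> {a..c}" if "x \<in> S'" for x
    using that Suc.prems(3) Max_ge[OF S'(1) that] by (auto simp: c_def S'_def)
  then have "S' \<subseteq> {a..c}"
    by blast
  then obtain T where T: "T \<subseteq> {a<..<c}" "finite T" "card T = k" "\<forall>x\<in>T. poly (pderiv f) x = 0"
    using Suc.IH[of S' c] S' Suc.prems(4) by (force simp: S'_def)
  obtain z where z: "c < z" "z < M" "poly f M - poly f c = (M - c) * poly (pderiv f) z"
    using poly_MVT[OF \<open>c < M\<close>, of f] by blast
  have "poly (pderiv f) z = 0"
    using z Suc.prems(4) M c by (auto simp: S'_def)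
  moreover have "z \<notin> T"
    using T z by auto
  moreover have "insert z T \<subseteq> {a<..<b}"
    using T(1) z M c Suc.prems(3) by (fastforce simp: S'_def)
  ultimately show ?case
    using T by (intro exI[of _ "insert z T"]) auto
qed

section \<open>Derivatives of powers of x^2 - 1\<close>

lemma power_dvd_pderiv:
  fixes q f :: "real poly"
  assumes "q ^ Suc k dvd f"
  shows "q ^ k dvd pderiv f"
proof -
  obtain g where "f = q ^ Suc k * g"
    using assms by (elim dvdE)
  then show ?thesis
    by (simp only: pderiv_mult pderiv_power_Suc) (intro dvd_add; simp add: dvd_mult dvd_mult2 dvd_smult)
qed

lemma power_dvd_higher_pderiv:
  fixes q :: "real poly"
  shows "j \<le> m \<Longrightarrow> q ^ (m - j) dvd (pderiv ^^ j) (q ^ m)"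
proof (induction j)
  case (Suc j)
  then show ?case
    using power_dvd_pderiv[of q "m - Suc j"] by (simp add: Suc_diff_Suc del: power_Suc)
qed simp

text \<open>Each derivative costs at most one factor x^2 - 1, so one survives as long as
  \<open>j < m\<close>. This removes the boundary terms when integrating by parts.\<close>

lemma higher_pderiv_power_at_ends:
  fixes m j :: nat
  assumes "j < m" "x = 1 \<or> x = -1"
  shows "poly ((pderiv ^^ j) ([:-1, 0, 1:] ^ m)) x = (0::real)"
proof -
  have "poly ([:-1, 0, 1:] ^ (m - j)) x = 0"
    using assms by (auto simp: power_0_left)
  then show ?thesis
    using power_dvd_higher_pderiv[of j m "[:-1, 0, 1:]"] assms(1) by (auto elim!: dvdE)
qed

text \<open>The k interior zeros of the k-th derivative and, while \<open>k < m\<close>, the two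
  endpoints make k + 2 zeros, so Rolle's theorem yields k + 1 interior zeros of the next
  derivative.\<close>

lemma higher_pderiv_power_roots:
  fixes m k :: nat
  assumes "k \<le> m"
  shows "\<exists>T \<subseteq> {-1<..<1::real}. finite T \<and> card T = k \<and>
    (\<forall>x\<in>T. poly ((pderiv ^^ k) ([:-1, 0, 1:] ^ m)) x = 0)"
  using assms
proof (induction k)
  case 0
  then show ?case by (intro exI[of _ "{}"]) auto
next
  case (Suc k)
  then obtain T where T: "T \<subseteq> {-1<..<1::real}" "finite T" "card T = k"
    "\<forall>x\<in>T. poly ((pderiv ^^ k) ([:-1, 0, 1:] ^ m)) x = 0"
    by auto
  let ?S = "insert (-1) (insert 1 T)"
  have S: "finite ?S" "card ?S = Suc (Suc k)" "?S \<subseteq> {-1..1}"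
    using T by (auto simp: card_insert_if)
  have "poly ((pderiv ^^ k) ([:-1, 0, 1:] ^ m)) x = 0" if "x \<in> ?S" for x
    using that T higher_pderiv_power_at_ends[of k m x] Suc.prems by auto
  from poly_rolle_card[OF S this] show ?case
    by simp
qed

section \<open>Degree and orthogonality of the Legendre polynomials\<close>

lemma degree_legendre: "degree (legendre m) = m"
  unfolding legendre_def
  by (simp add: degree_higher_pderiv degree_power_eq)

lemma legendre_nonzero: "legendre m \<noteq> 0"
  unfolding legendre_def
  by (cases "m = 0") (auto simp: degree_higher_pderiv degree_power_eq
      dest!: arg_cong[of _ _ degree])

text \<open>Integration by parts moves one derivative at a time onto \<open>q\<close>, without
  boundary terms; since \<open>degree q < j\<close>, the derivatives of \<open>q\<close> become zero
  before the supply runs out.\<close>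

lemma integral_higher_pderiv_power_mult:
  fixes q :: "real poly"
  assumes "j \<le> m" "degree q < j"
  shows "integral {-1..1} (poly ((pderiv ^^ j) ([:-1, 0, 1:] ^ m) * q)) = 0"
  using assms
proof (induction j arbitrary: q)
  case (Suc j)
  let ?u = "(pderiv ^^ j) ([:-1, 0, 1:] ^ m) :: real poly"
  have "pderiv (?u * q) = ?u * pderiv q + pderiv ?u * q"
    by (simp add: pderiv_mult)
  then have "integral {-1..1} (poly (pderiv ?u * q))
      = integral {-1..1} (poly (pderiv (?u * q))) - integral {-1..1} (poly (?u * pderiv q))"
    by (simp add: integral_poly_add)
  also have "integral {-1..1} (poly (pderiv (?u * q))) = 0"
    using Suc.prems by (simp add: integral_poly_pderiv higher_pderiv_power_at_ends)
  also have "integral {-1..1} (poly (?u * pderiv q)) = 0"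
  \<comment> \<open>For constant \<open>q\<close> the degree does not drop, so the induction
    hypothesis may not apply, but then \<open>pderiv q\<close> is zero.\<close>
  proof (cases "degree q = 0")
    case True
    then have "?u * pderiv q = 0"
      by (simp add: pderiv_eq_0_iff)
    then show ?thesis
      by (simp only: integral_poly_0)
  next
    case False
    then show ?thesis
      using Suc.prems by (intro Suc.IH) (auto simp: degree_pderiv)
  qed
  finally show ?case by simp
qed simp

lemma legendre_orthogonal:
  assumes "degree q < m"
  shows "integral {-1..1} (poly (legendre m * q)) = 0"
  using integral_higher_pderiv_power_mult[of m m q] assms
  by (simp add: legendre_def integral_poly_smult)

lemma legendre_norm_pos: "integral {-1..1} (poly (legendre m * legendre m)) > 0"
  by (rule integral_poly_pos) (auto simp: legendre_nonzero)

text \<open>Testing against the Legendre polynomial of degree \<open>degree r\<close> isolates the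
  leading term: the rest \<open>t\<close> has lower degree and is orthogonal to it.\<close>

lemma legendre_orthogonal_eq_0:
  assumes "degree r \<le> p" and orth: "\<And>j. j \<le> p \<Longrightarrow> integral {-1..1} (poly (legendre j * r)) = 0"
  shows "r = 0"
proof (rule ccontr)
  assume "r \<noteq> 0"
  define d where "d = degree r"
  define c where "c = lead_coeff r / lead_coeff (legendre d)"
  define t where "t = r - Polynomial.smult c (legendre d)"
  have c: "c \<noteq> 0"
    using \<open>r \<noteq> 0\<close> legendre_nonzero by (simp add: c_def)
  have "integral {-1..1} (poly (legendre d * t)) = 0"
  proof (cases "t = 0")
    case False
    have "Polynomial.coeff t d = 0"
      using leading_coeff_neq_0[OF legendre_nonzero[of d]] by (simp add: t_def c_def d_def degree_legendre)
    moreover have "degree t \<le> d"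
      unfolding t_def by (intro degree_diff_le) (auto simp: d_def degree_legendre intro: order_trans[OF degree_smult_le])
    ultimately have "degree t < d"
      using False by (metis leading_coeff_0_iff le_neq_implies_less)
    then show ?thesis
      by (rule legendre_orthogonal)
  qed simp
  moreover have "legendre d * r = legendre d * t + Polynomial.smult c (legendre d * legendre d)"
    by (simp add: t_def algebra_simps)
  ultimately have "integral {-1..1} (poly (legendre d * r))
      = c * integral {-1..1} (poly (legendre d * legendre d))"
    by (simp only: integral_poly_add integral_poly_smult add_0)
  moreover have "integral {-1..1} (poly (legendre d * r)) = 0"
    using orth assms(1) d_def by blast
  ultimately show False
    using c legendre_norm_pos[of d] by simp
qed

section \<open>Legendre-Gauss-Lobatto quadrature\<close>

text \<open>The degree of the derivative bounds the count from above. From below, the Legendre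
  polynomial has \<open>Suc m\<close> zeros in the open interval by Rodrigues' formula, and Rolle's
  theorem puts m zeros of its derivative between them.\<close>

lemma lgl_interior_card:
  "finite {x \<in> {-1<..<1::real}. poly (pderiv (legendre (Suc m))) x = 0}" (is "finite ?Z")
  "card {x \<in> {-1<..<1::real}. poly (pderiv (legendre (Suc m))) x = 0} = m"
proof -
  let ?L = "legendre (Suc m)"
  have "pderiv ?L \<noteq> 0"
    by (simp add: pderiv_eq_0_iff degree_legendre)
  then have fin: "finite {x. poly (pderiv ?L) x = 0}"
    and card: "card {x. poly (pderiv ?L) x = 0} \<le> m"
    using card_poly_roots_bound[of "pderiv ?L"]
    by (auto simp: poly_roots_finite degree_pderiv degree_legendre)
  then show finZ: "finite ?Z"
    by (rule_tac finite_subset) auto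
  obtain T where T: "T \<subseteq> {-1<..<1::real}" "finite T" "card T = Suc m"
    "\<forall>x\<in>T. poly ((pderiv ^^ Suc m) ([:-1, 0, 1:] ^ Suc m)) x = 0"
    using higher_pderiv_power_roots[of "Suc m" "Suc m"] by blast
  have T0: "poly ?L x = 0" if "x \<in> T" for x
    using T(4) that unfolding legendre_def poly_smult by simp
  obtain U where U: "U \<subseteq> {-1<..<1::real}" "finite U" "card U = m"
    "\<forall>x\<in>U. poly (pderiv ?L) x = 0"
    using poly_rolle_card[of T m "-1" 1 ?L] T T0 by force
  have "m \<le> card ?Z"
    using U finZ by (subst U(3)[symmetric], intro card_mono) auto
  moreover have "card ?Z \<le> m"
    using card fin by (intro order_trans[OF card_mono card]) auto
  ultimately show "card ?Z = m"
    by simp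
qed

text \<open>The interior zeros lie in the open interval, hence are distinct from the endpoints, and
  the count is 2 + (n - 2). So the indices below \<open>n\<close> address exactly the nodes.\<close>

lemma lgl_nodes_props:
  assumes "n \<ge> 2"
  shows "length (lgl_nodes n) = n" "distinct (lgl_nodes n)"
    "set (lgl_nodes n) = {-1, 1} \<union> {x \<in> {-1<..<1}. poly (pderiv (legendre (n - 1))) x = 0}"
proof -
  obtain m where m: "n = Suc (Suc m)"
    using assms by (metis add_2_eq_Suc le_Suc_ex)
  let ?Z = "{x \<in> {-1<..<1::real}. poly (pderiv (legendre (n - 1))) x = 0}"
  have Z: "finite ?Z" "card ?Z = m"
    using lgl_interior_card[of m] by (simp_all add: m)
  then have "card ({-1, 1} \<union> ?Z) = n"
    by (auto simp: card_insert_if m)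
  then show "length (lgl_nodes n) = n"
    using Z by (simp add: lgl_nodes_def)
  show "distinct (lgl_nodes n)"
    by (simp add: lgl_nodes_def)
  show "set (lgl_nodes n) = {-1, 1} \<union> ?Z"
    using Z by (subst lgl_nodes_def, subst set_sorted_list_of_set) auto
qed

lemma lgl_node_inj: "n \<ge> 2 \<Longrightarrow> inj_on (lgl_node n) {..<n}"
  using lgl_nodes_props[of n] by (simp add: inj_on_def nth_eq_iff_index_eq)

lemma lgl_node_eq_iff:
  "n \<ge> 2 \<Longrightarrow> i < n \<Longrightarrow> j < n \<Longrightarrow> lgl_node n i = lgl_node n j \<longleftrightarrow> i = j"
  using lgl_node_inj[of n] by (auto simp: inj_on_def)

lemma lgl_node_cases:
  assumes "n \<ge> 2" "i < n"
  shows "lgl_node n i = -1 \<or> lgl_node n i = 1 \<or>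
    lgl_node n i \<in> {-1<..<1} \<and> poly (pderiv (legendre (n - 1))) (lgl_node n i) = 0"
  using assms lgl_nodes_props[of n] nth_mem[of i "lgl_nodes n"] by auto

lemma lgl_node_bounds: "n \<ge> 2 \<Longrightarrow> i < n \<Longrightarrow> lgl_node n i \<in> {-1..1}"
  using lgl_node_cases[of n i] by auto

section \<open>Lagrange interpolation at the nodes\<close>

lemma poly_eq_if_eq_at_lgl_nodes:
  assumes "n \<ge> 2" "degree f < n" "degree g < n"
    and "\<And>i. i < n \<Longrightarrow> poly f (lgl_node n i) = poly g (lgl_node n i)"
  shows "f = g"
proof (rule poly_eqI_degree[where A = "lgl_node n ` {..<n}"])
  show "degree f < card (lgl_node n ` {..<n})" "degree g < card (lgl_node n ` {..<n})"
    using assms lgl_node_inj by (simp_all add: card_image)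
qed (use assms in auto)

lemma lagrange_basis_at_node:
  assumes "n \<ge> 2" "i < n" "j < n"
  shows "poly (lagrange_basis n i) (lgl_node n j) = (if i = j then 1 else 0)"
proof (cases "i = j")
  case True
  then show ?thesis
    using assms by (auto simp: lagrange_basis_def poly_prod lgl_node_eq_iff diff_divide_distrib[symmetric] intro!: prod.neutral)
next
  case False
  then show ?thesis
    using assms by (auto simp: lagrange_basis_def poly_prod)
qed

lemma degree_lagrange_basis:
  assumes "i < n"
  shows "degree (lagrange_basis n i) \<le> n - 1"
proof -
  have "degree (lagrange_basis n i) \<le>
      (\<Sum>j\<in>{..<n} - {i}. degree (Polynomial.smult (1 / (lgl_node n i - lgl_node n j)) [:- lgl_node n j, 1:]))"
    unfolding lagrange_basis_def using degree_prod_sum_le[unfolded o_def] by blast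
  also have "\<dots> \<le> (\<Sum>j\<in>{..<n} - {i}. 1)"
    by (intro sum_mono) simp
  also have "\<dots> = n - 1"
    using assms by simp
  finally show ?thesis .
qed

lemma lagrange_interpolation:
  assumes "n \<ge> 2" "degree f < n"
  shows "f = (\<Sum>i<n. Polynomial.smult (poly f (lgl_node n i)) (lagrange_basis n i))"
proof (rule poly_eq_if_eq_at_lgl_nodes[OF assms])
  have "degree (\<Sum>i<n. Polynomial.smult (poly f (lgl_node n i)) (lagrange_basis n i)) \<le> n - 1"
    by (intro degree_sum_le order_trans[OF degree_smult_le] degree_lagrange_basis) auto
  then show "degree (\<Sum>i<n. Polynomial.smult (poly f (lgl_node n i)) (lagrange_basis n i)) < n"
    using assms by linarith
  show "poly f (lgl_node n j) =
      poly (\<Sum>i<n. Polynomial.smult (poly f (lgl_node n i)) (lagrange_basis n i)) (lgl_node n j)"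
    if "j < n" for j
    using assms that by (simp add: poly_sum lagrange_basis_at_node if_distrib[of "\<lambda>x. _ * x"] cong: if_cong)
qed

section \<open>Exactness of the quadrature and positivity of its weights\<close>

lemma lgl_exact_interpolatory:
  assumes "n \<ge> 2" "degree f < n"
  shows "integral {-1..1} (poly f) = (\<Sum>i<n. lgl_weight n i * poly f (lgl_node n i))"
  by (subst lagrange_interpolation[OF assms])
    (simp add: integral_poly_sum integral_poly_smult lgl_weight_def mult.commute)

(* A polynomial of degree at most 2n - 3 is, modulo a multiple of (1 - x^2) P'_{n-1}, of degree
   below n; integration by parts turns the multiple into an integral of P_{n-1} against a
   polynomial of degree at most n - 2, which vanishes. *)
lemma lgl_exact:
  assumes "n \<ge> 2" "degree f \<le> 2 * n - 3"
  shows "integral {-1..1} (poly f) = (\<Sum>i<n. lgl_weight n i * poly f (lgl_node n i))"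
proof -
  define L where "L = legendre (n - 1)"
  define b where "b = [:1, 0, -1::real:]"
  define N where "N = b * pderiv L"
  define q where "q = f div N"
  define r where "r = f mod N"
  have f: "f = q * N + r"
    by (simp add: q_def r_def)
  have dL: "degree L = n - 1"
    by (simp add: L_def degree_legendre)
  then have L': "pderiv L \<noteq> 0"
    using assms(1) by (simp add: pderiv_eq_0_iff)
  have "b \<noteq> 0"
    by (simp add: b_def)
  with L' have N0: "N \<noteq> 0"
    by (simp add: N_def)
  have "degree N = 2 + (n - 2)"
    using L' dL \<open>b \<noteq> 0\<close> by (simp add: N_def degree_mult_eq degree_pderiv) (simp add: b_def)
  then have dN: "degree N = n"
    using assms(1) by simp
  have dr: "degree r < n"
    using degree_mod_less'[OF N0, of f] dN assms(1) by (cases "r = 0") (auto simp: r_def)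
  \<comment> \<open>Every node is a zero of \<open>N\<close>, so \<open>f\<close> and
    \<open>r\<close> have the same quadrature sum.\<close>
  have Nnode: "poly N (lgl_node n i) = 0" if "i < n" for i
    using lgl_node_cases[OF assms(1) that] by (auto simp: N_def b_def L_def)
  have "integral {-1..1} (poly (q * N)) = 0"
  proof (cases "q = 0")
    case False
    \<comment> \<open>The leading term of \<open>q * N\<close> cannot cancel against
      \<open>r\<close>, whose degree is below \<open>degree N\<close>, so the product inherits the
      degree bound of \<open>f\<close>.\<close>
    have "degree (q * N) \<le> 2 * n - 3"
    proof (rule ccontr)
      assume *: "\<not> ?thesis"
      then have "degree r < degree (q * N)"
        using dr dN assms(1) False N0 by (simp add: degree_mult_eq)
      then have "degree f = degree (q * N)"
        unfolding f by (rule degree_add_eq_left)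
      then show False
        using * assms(2) by simp
    qed
    then have dq: "degree q + n \<le> 2 * n - 3"
      using False N0 dN by (simp add: degree_mult_eq)
    have "degree (b * q) = degree q + 2"
      using False \<open>b \<noteq> 0\<close> by (simp add: degree_mult_eq) (simp add: b_def)
    then have "degree (pderiv (b * q)) < n - 1"
      using dq assms(1) by (simp add: degree_pderiv)
    then have "integral {-1..1} (poly (L * pderiv (b * q))) = 0"
      unfolding L_def by (rule legendre_orthogonal)
    \<comment> \<open>The factor \<open>b\<close>, which is 1 - x^2, removes the boundary
      values.\<close>
    moreover have "integral {-1..1} (poly (pderiv (L * (b * q)))) = 0"
      by (simp add: integral_poly_pderiv b_def)
    moreover have "pderiv (L * (b * q)) = L * pderiv (b * q) + q * N"
      by (simp only: pderiv_mult[of L] N_def mult_ac)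
    ultimately show ?thesis
      by (simp only: integral_poly_add)
  qed simp
  then have "integral {-1..1} (poly f) = integral {-1..1} (poly r)"
    by (subst f) (simp add: integral_poly_add del: f)
  also have "\<dots> = (\<Sum>i<n. lgl_weight n i * poly r (lgl_node n i))"
    using assms(1) dr by (rule lgl_exact_interpolatory)
  also have "\<dots> = (\<Sum>i<n. lgl_weight n i * poly f (lgl_node n i))"
    by (rule sum.cong) (simp_all add: f Nnode)
  finally show ?thesis .
qed

text \<open>Exactness turns the positive integral of \<open>f\<close> into the single quadrature
  term at node \<open>i\<close>, whose factor \<open>poly f (lgl_node n i)\<close> is
  nonnegative.\<close>

lemma lgl_weight_pos_if_witness:
  assumes "n \<ge> 2" "i < n" "degree f \<le> 2 * n - 3"
    and "\<And>x. x \<in> {-1..1} \<Longrightarrow> poly f x \<ge> 0"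
    and "poly f (lgl_node n i) \<noteq> 0"
    and "\<And>j. j < n \<Longrightarrow> j \<noteq> i \<Longrightarrow> poly f (lgl_node n j) = 0"
  shows "lgl_weight n i > 0"
proof -
  have "0 < integral {-1..1} (poly f)"
    using assms(4,5) by (intro integral_poly_pos) auto
  also have "\<dots> = (\<Sum>j<n. if j = i then lgl_weight n i * poly f (lgl_node n i) else 0)"
    unfolding lgl_exact[OF assms(1,3)] using assms(6) by (intro sum.cong) auto
  also have "\<dots> = lgl_weight n i * poly f (lgl_node n i)"
    using assms(2) by simp
  finally show ?thesis
    using assms(4)[OF lgl_node_bounds[OF assms(1,2)]] by (simp add: zero_less_mult_iff)
qed

text \<open>The witness is the squared product of the \<open>x - z\<close> over the other interior nodes \<open>z\<close>, times
  \<open>1 - x\<^sup>2\<close> at an interior node and \<open>1 - x\<close> or \<open>1 + x\<close> at an endpoint.\<close>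
lemma lgl_weight_pos:
  assumes n: "n \<ge> 2" and i: "i < n"
  shows "lgl_weight n i > 0"
proof -
  define x where "x = lgl_node n i"
  define Z where "Z = {x \<in> {-1<..<1::real}. poly (pderiv (legendre (n - 1))) x = 0}"
  define e where "e = (if x = -1 then [:1, -1:] else if x = 1 then [:1, 1:] else [:1, 0, -1::real:])"
  define g where "g = (\<Prod>z\<in>Z - {x}. [:- z, 1:])"
  have Z: "finite Z" "card Z = n - 2"
    using lgl_interior_card[of "n - 2"] n unfolding Z_def by (simp_all add: Suc_diff_Suc numeral_2_eq_2)
  have x: "x = -1 \<or> x = 1 \<or> x \<in> Z"
    using lgl_node_cases[OF n i] by (auto simp: x_def Z_def)
  have dg: "degree g = card (Z - {x})"
    unfolding g_def by (subst degree_prod_eq_sum_degree) auto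
  have "degree (e * g\<^sup>2) \<le> degree e + 2 * card (Z - {x})"
    using degree_mult_le[of e "g\<^sup>2"] degree_power_le[of g 2] dg by simp
  \<comment> \<open>The degree is 2 + 2(n - 3) at an interior node and 1 + 2(n - 2) at an endpoint;
    the latter uses up the full degree of exactness.\<close>
  also have "\<dots> \<le> 2 * n - 3"
  proof (cases "x \<in> Z")
    case True
    then have "x \<noteq> -1" "x \<noteq> 1"
      by (auto simp: Z_def)
    moreover have "card Z > 0"
      using True Z(1) by (auto simp: card_gt_0_iff)
    ultimately show ?thesis
      using True Z by (simp add: e_def)
  next
    case False
    then show ?thesis
      using x Z n by (auto simp: e_def)
  qed
  finally have deg: "degree (e * g\<^sup>2) \<le> 2 * n - 3" .
  show ?thesis
  proof (rule lgl_weight_pos_if_witness[OF n i deg])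
    show "poly (e * g\<^sup>2) y \<ge> 0" if "y \<in> {-1..1}" for y
    proof -
      have "1 - y * y = (1 - y) * (1 + y)"
        by (simp add: algebra_simps)
      then have "1 - y * y \<ge> 0"
        using that by simp
      then have "poly e y \<ge> 0"
        using that by (auto simp: e_def)
      then show ?thesis
        by simp
    qed
    have "x * x \<noteq> 1" if "x \<in> Z"
    proof -
      have "1 - x * x = (1 - x) * (1 + x)"
        by (simp add: algebra_simps)
      then show ?thesis
        using that by (auto simp: Z_def)
    qed
    then have "poly e x \<noteq> 0"
      using x by (auto simp: e_def)
    moreover have "poly g x \<noteq> 0"
      using Z by (auto simp: g_def poly_prod)
    ultimately show "poly (e * g\<^sup>2) (lgl_node n i) \<noteq> 0"
      by (simp add: x_def)
    show "poly (e * g\<^sup>2) (lgl_node n j) = 0" if "j < n" "j \<noteq> i" for j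
    proof -
      have ne: "lgl_node n j \<noteq> x"
        using lgl_node_eq_iff[OF n \<open>j < n\<close> i] that by (simp add: x_def)
      have "lgl_node n j = -1 \<or> lgl_node n j = 1 \<or> lgl_node n j \<in> Z"
        using lgl_node_cases[OF n \<open>j < n\<close>] by (auto simp: Z_def)
      then have "poly e (lgl_node n j) = 0 \<or> poly g (lgl_node n j) = 0"
        using ne Z by (auto simp: e_def g_def poly_prod)
      then show ?thesis
        by auto
    qed
  qed
qed

section \<open>Matrices annihilating nodal values\<close>

lemma nodal_values_carrier [simp]: "nodal_values n q \<in> carrier_vec n"
  by (simp add: nodal_values_def)

lemma nodal_values_index [simp]: "i < n \<Longrightarrow> nodal_values n q $ i = poly q (lgl_node n i)"
  by (simp add: nodal_values_def)

lemma dim_nodal_values [simp]: "dim_vec (nodal_values n q) = n"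
  by (simp add: nodal_values_def)

lemma mult_nodal_values_index:
  "B \<in> carrier_mat m n \<Longrightarrow> i < m \<Longrightarrow>
    (B *\<^sub>v nodal_values n q) $ i = (\<Sum>j<n. B $$ (i, j) * poly q (lgl_node n j))"
  by (simp add: scalar_prod_def lessThan_atLeast0)

text \<open>Lets the image of a nodal vector under \<open>D\<close> be treated as a nodal vector
  again.\<close>

lemma nodal_values_surj:
  assumes "n \<ge> 2" "v \<in> carrier_vec n"
  obtains q where "degree q < n" "v = nodal_values n q"
proof
  let ?q = "\<Sum>i<n. Polynomial.smult (v $ i) (lagrange_basis n i)"
  have "degree ?q \<le> n - 1"
    by (intro degree_sum_le order_trans[OF degree_smult_le] degree_lagrange_basis) auto
  then show "degree ?q < n"
    using assms by linarith
  show "v = nodal_values n ?q"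
    using assms
    by (intro eq_vecI) (simp_all add: poly_sum lagrange_basis_at_node if_distrib[of "\<lambda>x. _ * x"] cong: if_cong)
qed

text \<open>Column \<open>j\<close> of \<open>B\<close> is the image of the nodal vector of the
  Lagrange polynomial \<open>?l\<close>. Subtracting its term in x^(p+1) leaves degree at most
  \<open>p\<close>, which \<open>B\<close> annihilates, so only the image of that term
  remains.\<close>

lemma rank_one_if_annihilates:
  assumes "n = p + 2" "B \<in> carrier_mat n n"
    and ann: "\<And>q. degree q \<le> p \<Longrightarrow> B *\<^sub>v nodal_values n q = 0\<^sub>v n"
    and "i < n" "j < n"
  shows "B $$ (i, j) = (B *\<^sub>v nodal_values n (Polynomial.monom 1 (p + 1))) $ i
    * Polynomial.coeff (lagrange_basis n j) (p + 1)"
proof -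
  let ?l = "lagrange_basis n j"
  define c where "c = Polynomial.coeff ?l (p + 1)"
  define q where "q = ?l - Polynomial.smult c (Polynomial.monom 1 (p + 1))"
  have n: "n \<ge> 2"
    using assms(1) by simp
  have "degree ?l \<le> p + 1"
    using degree_lagrange_basis[of j n] assms(1,5) by simp
  then have "degree q \<le> p"
    by (intro degree_le) (auto simp: q_def c_def coeff_eq_0)
  then have "(B *\<^sub>v nodal_values n q) $ i = 0"
    using ann assms(4) by (simp del: index_mult_mat_vec)
  then have "(\<Sum>k<n. B $$ (i, k) * poly q (lgl_node n k)) = 0"
    by (simp only: mult_nodal_values_index[OF assms(2,4)])
  moreover have "(\<Sum>k<n. B $$ (i, k) * poly ?l (lgl_node n k)) = B $$ (i, j)"
    using n assms(5) by (simp add: lagrange_basis_at_node if_distrib[of "\<lambda>x. _ * x"] cong: if_cong)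
  moreover have "(\<Sum>k<n. B $$ (i, k) * poly q (lgl_node n k))
      = (\<Sum>k<n. B $$ (i, k) * poly ?l (lgl_node n k))
        - c * (B *\<^sub>v nodal_values n (Polynomial.monom 1 (p + 1))) $ i"
    unfolding mult_nodal_values_index[OF assms(2,4)]
    by (simp add: q_def algebra_simps sum_subtractf sum_distrib_left)
  ultimately show ?thesis
    by (simp add: c_def mult.commute)
qed

section \<open>Dissipation matrices of rank one\<close>

lemma derivative_dissipation_index:
  assumes "B \<in> carrier_mat n n" "j < n" "k < n"
  shows "derivative_dissipation n \<A> B $$ (j, k)
    = (\<Sum>i<n. lgl_weight n i * \<A> (lgl_node n i) * B $$ (i, j) * B $$ (i, k))"
proof -
  have "transpose_mat B * H_mat n * A_mat n \<A>
      = mat n n (\<lambda>(j, i). B $$ (i, j) * lgl_weight n i * \<A> (lgl_node n i))"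
    unfolding H_mat_def A_mat_def using assms
    by (subst mat_diag_mult_right[of _ n n], simp, subst mat_diag_mult_right[of _ n n])
      (auto intro!: eq_matI)
  then show ?thesis
    using assms
    by (simp add: derivative_dissipation_def scalar_prod_def lessThan_atLeast0 mult_ac)
qed

lemma derivative_dissipation_carrier:
  "B \<in> carrier_mat n n \<Longrightarrow> derivative_dissipation n \<A> B \<in> carrier_mat n n"
  unfolding derivative_dissipation_def H_mat_def A_mat_def
  by (intro mult_carrier_mat[of _ n n] mat_diag_dim) simp_all

text \<open>Stated for an arbitrary \<open>B\<close> so as to cover both \<open>Ds\<close> and
  \<open>P_mat n p\<close>. The matrix next to \<open>\<gamma>\<close> does not involve
  \<open>B\<close>, which makes the two results comparable.\<close>

lemma derivative_dissipation_rank_one: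
  fixes \<A> :: "real \<Rightarrow> real"
  assumes n: "n = p + 2" and B: "B \<in> carrier_mat n n" "B \<noteq> 0\<^sub>m n n"
    and ann: "\<And>q. degree q \<le> p \<Longrightarrow> B *\<^sub>v nodal_values n q = 0\<^sub>v n"
    and \<A>: "\<And>x. x \<in> {-1..1} \<Longrightarrow> \<A> x > 0"
  obtains \<gamma> where "\<gamma> > 0"
    "derivative_dissipation n \<A> B = \<gamma> \<cdot>\<^sub>m mat n n (\<lambda>(j, k).
       Polynomial.coeff (lagrange_basis n j) (p + 1) * Polynomial.coeff (lagrange_basis n k) (p + 1))"
proof
  define u where "u = B *\<^sub>v nodal_values n (Polynomial.monom 1 (p + 1))"
  define c where "c j = Polynomial.coeff (lagrange_basis n j) (p + 1)" for j
  \<comment> \<open>This is u^T H A u, the scalar in the middle of (u c^T)^T H A (u c^T).\<close>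
  let ?\<gamma> = "\<Sum>i<n. lgl_weight n i * \<A> (lgl_node n i) * (u $ i)\<^sup>2"
  have Bij: "B $$ (i, j) = u $ i * c j" if "i < n" "j < n" for i j
    unfolding u_def c_def by (rule rank_one_if_annihilates[OF n B(1) ann that])
  have pos: "lgl_weight n i * \<A> (lgl_node n i) > 0" if "i < n" for i
    using that n lgl_weight_pos[of n i] \<A>[OF lgl_node_bounds[of n i]] by simp
  have "\<exists>i<n. u $ i \<noteq> 0"
  proof (rule ccontr)
    assume "\<not> ?thesis"
    then have "B = 0\<^sub>m n n"
      using B(1) Bij by (intro eq_matI) auto
    with B(2) show False ..
  qed
  then obtain i where "i < n" "u $ i \<noteq> 0"
    by blast
  then show "?\<gamma> > 0"
    using pos by (intro sum_pos2[of _ i]) (auto intro!: mult_nonneg_nonneg[OF less_imp_le])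
  have "derivative_dissipation n \<A> B = ?\<gamma> \<cdot>\<^sub>m mat n n (\<lambda>(j, k). c j * c k)"
  proof (rule eq_matI)
    fix j k
    assume "j < dim_row (?\<gamma> \<cdot>\<^sub>m mat n n (\<lambda>(j, k). c j * c k))"
      and "k < dim_col (?\<gamma> \<cdot>\<^sub>m mat n n (\<lambda>(j, k). c j * c k))"
    then have jk: "j < n" "k < n"
      by simp_all
    have "derivative_dissipation n \<A> B $$ (j, k)
        = (\<Sum>i<n. lgl_weight n i * \<A> (lgl_node n i) * (u $ i)\<^sup>2 * (c j * c k))"
      unfolding derivative_dissipation_index[OF B(1) jk]
      by (rule sum.cong) (simp_all add: Bij jk power2_eq_square)
    then show "derivative_dissipation n \<A> B $$ (j, k)
        = (?\<gamma> \<cdot>\<^sub>m mat n n (\<lambda>(j, k). c j * c k)) $$ (j, k)"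
      using jk by (simp add: sum_distrib_right)
  qed (use derivative_dissipation_carrier[OF B(1), of \<A>] in simp_all)
  then show "derivative_dissipation n \<A> B = ?\<gamma> \<cdot>\<^sub>m mat n n (\<lambda>(j, k).
       Polynomial.coeff (lagrange_basis n j) (p + 1) * Polynomial.coeff (lagrange_basis n k) (p + 1))"
    by (simp add: c_def)
qed

section \<open>The projection matrix\<close>

lemma degree_legendre_normalized: "degree (legendre_normalized j) \<le> j"
  unfolding legendre_normalized_def by (rule order_trans[OF degree_smult_le]) (simp add: degree_legendre)

lemma legendre_normalized_orthonormal:
  "integral {-1..1} (poly (legendre_normalized j * legendre_normalized k)) = (if j = k then 1 else 0)"
proof -
  define N where "N m = integral {-1..1} (poly (legendre m * legendre m))" for m
  have N: "N m > 0" for m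
    unfolding N_def by (rule legendre_norm_pos)
  have norm: "legendre_normalized m = Polynomial.smult (1 / sqrt (N m)) (legendre m)" for m
    by (simp add: legendre_normalized_def N_def power2_eq_square poly_mult[abs_def])
  have "integral {-1..1} (poly (legendre j * legendre k)) = (if j = k then N j else 0)"
    using legendre_orthogonal[of "legendre j" k] legendre_orthogonal[of "legendre k" j]
    by (cases j k rule: linorder_cases) (simp_all add: N_def degree_legendre mult.commute)
  then show ?thesis
    using N[of j] by (auto simp: norm integral_poly_smult)
qed

lemma legendre_normalized_orthogonal_eq_0:
  assumes "degree r \<le> p"
    and "\<And>j. j \<le> p \<Longrightarrow> integral {-1..1} (poly (legendre_normalized j * r)) = 0"
  shows "r = 0"
proof (rule legendre_orthogonal_eq_0[OF assms(1)])
  fix j assume "j \<le> p"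
  have "integral {-1..1} (\<lambda>x. (poly (legendre j) x)\<^sup>2) > 0"
    using legendre_norm_pos[of j] by (simp add: power2_eq_square poly_mult[abs_def])
  then show "integral {-1..1} (poly (legendre j * r)) = 0"
    using assms(2)[OF \<open>j \<le> p\<close>]
    by (simp add: legendre_normalized_def integral_poly_smult)
qed

text \<open>By orthonormality the remainder \<open>r\<close> is orthogonal to all normalized
  Legendre polynomials up to degree \<open>p\<close>, and its own degree is at most
  \<open>p\<close>.\<close>

lemma legendre_expansion:
  assumes "degree q \<le> p"
  shows "q = (\<Sum>j\<le>p. Polynomial.smult (integral {-1..1} (poly (legendre_normalized j * q)))
    (legendre_normalized j))"
proof -
  let ?I = "\<lambda>f. integral {-1..1} (poly f)"
  define r where "r = q - (\<Sum>j\<le>p. Polynomial.smult (?I (legendre_normalized j * q)) (legendre_normalized j))"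
  have "r = 0"
  proof (rule legendre_normalized_orthogonal_eq_0)
    show "degree r \<le> p"
      unfolding r_def using assms
      by (intro degree_diff_le degree_sum_le order_trans[OF degree_smult_le]
          order_trans[OF degree_legendre_normalized]) auto
    fix k assume "k \<le> p"
    have "legendre_normalized k * q = legendre_normalized k * r
        + (\<Sum>j\<le>p. Polynomial.smult (?I (legendre_normalized j * q)) (legendre_normalized k * legendre_normalized j))"
      by (simp add: r_def algebra_simps sum_distrib_left)
    then have "?I (legendre_normalized k * q) = ?I (legendre_normalized k * r)
        + (\<Sum>j\<le>p. ?I (legendre_normalized j * q) * (if k = j then 1 else 0))"
      by (simp only: integral_poly_add integral_poly_sum finite_atMost integral_poly_smult
          legendre_normalized_orthonormal)
    then show "?I (legendre_normalized k * r) = 0"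
      using \<open>k \<le> p\<close> by (simp add: if_distrib[of "\<lambda>x. _ * x"] cong: if_cong)
  qed
  then show ?thesis
    by (simp add: r_def)
qed

section \<open>Action of the projection on nodal vectors\<close>

lemma P_mat_carrier: "P_mat n p \<in> carrier_mat n n"
  by (rule carrier_matI) (simp_all add: P_mat_def L_mat_def H_mat_def mat_diag_def)

lemma P_mat_index:
  assumes "i < n" "k < n"
  shows "P_mat n p $$ (i, k) = (if i = k then 1 else 0)
    - (\<Sum>j\<le>p. poly (legendre_normalized j) (lgl_node n i)
        * (lgl_weight n k * poly (legendre_normalized j) (lgl_node n k)))"
proof -
  have "L_mat n p * transpose_mat (L_mat n p) * H_mat n
      = mat n n (\<lambda>(i, k). (L_mat n p * transpose_mat (L_mat n p)) $$ (i, k) * lgl_weight n k)"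
    unfolding H_mat_def by (rule mat_diag_mult_right, rule carrier_matI) (simp_all add: L_mat_def)
  then show ?thesis
    using assms
    by (simp add: P_mat_def L_mat_def scalar_prod_def sum_distrib_left mult_ac
        atLeast0LessThan lessThan_Suc_atMost)
qed

text \<open>The discrete inner products in \<open>P_mat\<close> are true integrals here, so it
  subtracts the L2 projection even for the degree p + 1 just above its null space.\<close>

lemma P_mat_mult_nodal_values:
  assumes n: "n = p + 2" and f: "degree f \<le> p + 1" and i: "i < n"
  shows "(P_mat n p *\<^sub>v nodal_values n f) $ i = poly f (lgl_node n i)
    - (\<Sum>j\<le>p. poly (legendre_normalized j) (lgl_node n i)
        * integral {-1..1} (poly (legendre_normalized j * f)))"
proof -
  let ?L = "legendre_normalized" and ?x = "lgl_node n"
  have exact: "integral {-1..1} (poly (?L j * f))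
      = (\<Sum>k<n. lgl_weight n k * (poly (?L j) (?x k) * poly f (?x k)))" if "j \<le> p" for j
  proof -
    \<comment> \<open>The largest degree, p + (p + 1), equals 2n - 3 for n = p + 2: exactness just
      suffices.\<close>
    have "degree (?L j * f) \<le> 2 * n - 3"
      using degree_mult_le[of "?L j" f] degree_legendre_normalized[of j] that f n by simp
    then show ?thesis
      using n by (subst lgl_exact[of n]) auto
  qed
  have "(P_mat n p *\<^sub>v nodal_values n f) $ i
      = (\<Sum>k<n. (if i = k then 1 else 0) * poly f (?x k))
        - (\<Sum>k<n. \<Sum>j\<le>p. poly (?L j) (?x i) * (lgl_weight n k * (poly (?L j) (?x k) * poly f (?x k))))"
    using i by (simp add: mult_nodal_values_index[OF P_mat_carrier] P_mat_index left_diff_distrib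
        sum_subtractf sum_distrib_right mult.assoc del: index_mult_mat_vec)
  also have "(\<Sum>k<n. (if i = k then 1 else 0) * poly f (?x k)) = poly f (?x i)"
    using i by (simp add: if_distrib[of "\<lambda>x. x * _"] cong: if_cong)
  also have "(\<Sum>k<n. \<Sum>j\<le>p. poly (?L j) (?x i) * (lgl_weight n k * (poly (?L j) (?x k) * poly f (?x k))))
      = (\<Sum>j\<le>p. poly (?L j) (?x i) * integral {-1..1} (poly (?L j * f)))"
    by (subst sum.swap) (simp add: exact sum_distrib_left)
  finally show ?thesis .
qed

lemma P_mat_annihilates:
  assumes "n = p + 2" "degree q \<le> p"
  shows "P_mat n p *\<^sub>v nodal_values n q = 0\<^sub>v n"
proof (rule eq_vecI)
  fix i assume "i < dim_vec (0\<^sub>v n :: real vec)"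
  then have i: "i < n"
    by simp
  have "poly q (lgl_node n i) = (\<Sum>j\<le>p. poly (legendre_normalized j) (lgl_node n i)
        * integral {-1..1} (poly (legendre_normalized j * q)))"
    using arg_cong[OF legendre_expansion[OF assms(2)], of "\<lambda>f. poly f (lgl_node n i)"]
    by (simp add: poly_sum mult.commute)
  then show "(P_mat n p *\<^sub>v nodal_values n q) $ i = 0\<^sub>v n $ i"
    using assms i P_mat_mult_nodal_values[of n p q i] by simp
qed (use P_mat_carrier[of n p] in auto)

lemma P_mat_nonzero:
  assumes "n = p + 2"
  shows "P_mat n p \<noteq> 0\<^sub>m n n"
proof
  let ?v = "legendre (p + 1)"
  assume P: "P_mat n p = 0\<^sub>m n n"
  have "poly ?v (lgl_node n i) = 0" if "i < n" for i
  proof -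
    have "integral {-1..1} (poly (legendre_normalized j * ?v)) = 0" if "j \<le> p" for j
      using legendre_orthogonal[of "legendre_normalized j" "p + 1"]
        degree_legendre_normalized[of j] that by (simp add: mult.commute)
    then have "(P_mat n p *\<^sub>v nodal_values n ?v) $ i = poly ?v (lgl_node n i)"
      using that assms by (subst P_mat_mult_nodal_values) (simp_all add: degree_legendre)
    then show ?thesis
      using that P by (simp add: mult_nodal_values_index[of _ n n] del: index_mult_mat_vec)
  qed
  \<comment> \<open>Degree p + 1 is below the number n of nodes, so vanishing at all of them forces
    the zero polynomial.\<close>
  then have "?v = 0"
    using assms by (intro poly_eq_if_eq_at_lgl_nodes[of n]) (auto simp: degree_legendre)
  then show False
    using legendre_nonzero by blast
qed

section \<open>Summation-by-parts operators\<close>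

lemma sbp_operator_carrier: "sbp_operator n p D \<Longrightarrow> D \<in> carrier_mat n n"
  unfolding sbp_operator_def by (auto intro!: mult_carrier_mat[of _ n n])

lemma sbp_operator_exact:
  "sbp_operator n p D \<Longrightarrow> degree q \<le> p \<Longrightarrow> D *\<^sub>v nodal_values n q = nodal_values n (pderiv q)"
  by (simp add: sbp_operator_def)

text \<open>Here H D = Q, and exchanging \<open>f\<close> and \<open>g\<close> transposes Q, so only
  the two corner entries of Q + Q^T contribute.\<close>

lemma sbp_summation_by_parts:
  assumes n: "n \<ge> 2" and D: "sbp_operator n p D"
  shows "(\<Sum>i<n. lgl_weight n i * poly f (lgl_node n i) * (D *\<^sub>v nodal_values n g) $ i)
      + (\<Sum>i<n. lgl_weight n i * poly g (lgl_node n i) * (D *\<^sub>v nodal_values n f) $ i)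
    = poly f (lgl_node n (n - 1)) * poly g (lgl_node n (n - 1))
      - poly f (lgl_node n 0) * poly g (lgl_node n 0)" (is "?S f g + ?S g f = _")
proof -
  let ?x = "lgl_node n"
  define b :: "nat \<Rightarrow> real" where "b i = (if i = 0 then -1 else if i = n - 1 then 1 else 0)" for i
  have Dc: "D \<in> carrier_mat n n"
    using D by (rule sbp_operator_carrier)
  obtain Q where Q: "Q \<in> carrier_mat n n" "D = mat_diag n (\<lambda>i. 1 / lgl_weight n i) * Q"
    "Q + transpose_mat Q = mat_diag n b"
    using D unfolding sbp_operator_def b_def by auto
  \<comment> \<open>Positivity of the weights makes the division by them in \<open>D\<close>
    cancel.\<close>
  have QD: "lgl_weight n i * D $$ (i, j) = Q $$ (i, j)" if "i < n" "j < n" for i j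
    using that lgl_weight_pos[OF n that(1)] Q(1)
    by (simp add: Q(2) mat_diag_mult_left[of _ n n])
  have QQ: "Q $$ (i, j) + Q $$ (j, i) = (if i = j then b i else 0)" if "i < n" "j < n" for i j
    using arg_cong[OF Q(3), of "\<lambda>M. M $$ (i, j)"] that Q(1) by (auto simp: mat_diag_def)
  have S: "?S f g = (\<Sum>i<n. \<Sum>j<n. poly f (?x i) * poly g (?x j) * Q $$ (i, j))" for f g
    using QD by (auto simp: mult_nodal_values_index[OF Dc] sum_distrib_left mult_ac
        simp flip: QD simp del: index_mult_mat_vec intro!: sum.cong)
  have "?S g f = (\<Sum>i<n. \<Sum>j<n. poly f (?x i) * poly g (?x j) * Q $$ (j, i))"
    unfolding S by (subst sum.swap) (simp add: mult_ac)
  then have "?S f g + ?S g f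
      = (\<Sum>i<n. \<Sum>j<n. poly f (?x i) * poly g (?x j) * (Q $$ (i, j) + Q $$ (j, i)))"
    by (simp only: S sum.distrib distrib_left)
  also have "\<dots> = (\<Sum>i<n. poly f (?x i) * poly g (?x i) * b i)"
    by (simp add: QQ if_distrib[of "\<lambda>x. _ * x"] cong: if_cong)
  \<comment> \<open>As \<open>n \<ge> 2\<close>, the indices 0 and n - 1 differ and \<open>b\<close>
    splits into two indicators.\<close>
  also have "\<dots> = (\<Sum>i<n. (if i = n - 1 then poly f (?x i) * poly g (?x i) else 0)
      - (if i = 0 then poly f (?x i) * poly g (?x i) else 0))"
    using n by (intro sum.cong) (auto simp: b_def)
  also have "\<dots> = poly f (?x (n - 1)) * poly g (?x (n - 1)) - poly f (?x 0) * poly g (?x 0)"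
    using n by (simp add: sum_subtractf)
  finally show ?thesis .
qed

lemma mult_nodal_values_diff:
  assumes "B \<in> carrier_mat n n"
  shows "B *\<^sub>v nodal_values n (f - g) = B *\<^sub>v nodal_values n f - B *\<^sub>v nodal_values n g"
proof -
  have "nodal_values n (f - g) = nodal_values n f - nodal_values n g"
    by (intro eq_vecI) auto
  then show ?thesis
    using assms by (simp add: mult_minus_distrib_mat_vec)
qed

text \<open>Summation by parts against \<open>1\<close> shows that the boundary values of a kernel element agree;
  after subtracting them, summation by parts against an antiderivative of the Lagrange polynomial
  of an interior node shows that the value at that node vanishes.\<close>
lemma sbp_operator_kernel:
  assumes n: "n = p + 2" and D: "sbp_operator n p D" and ker: "D *\<^sub>v nodal_values n f = 0\<^sub>v n"
  obtains c where "nodal_values n f = nodal_values n [:c:]"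
proof
  let ?x = "lgl_node n"
  define c where "c = poly f (?x 0)"
  define g where "g = f - [:c:]"
  have n2: "n \<ge> 2"
    using n by simp
  have D1: "D *\<^sub>v nodal_values n [:a:] = 0\<^sub>v n" for a
    using sbp_operator_exact[OF D, of "[:a:]"] by (auto simp: pderiv_pCons nodal_values_def)
  have "poly f (?x (n - 1)) = poly f (?x 0)"
    using sbp_summation_by_parts[OF n2 D, of 1 f] D1[of 1] ker
    by (simp add: one_pCons del: index_mult_mat_vec)
  then have g0: "poly g (?x 0) = 0" "poly g (?x (n - 1)) = 0"
    by (simp_all add: g_def c_def)
  have Dg: "D *\<^sub>v nodal_values n g = 0\<^sub>v n"
    unfolding g_def mult_nodal_values_diff[OF sbp_operator_carrier[OF D]] ker D1 by simp
  have orth: "(\<Sum>i<n. lgl_weight n i * poly g (?x i) * poly (pderiv q) (?x i)) = 0" if "degree q \<le> p" for q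
    using sbp_summation_by_parts[OF n2 D, of q g] Dg g0
    by (simp add: sbp_operator_exact[OF D that] del: index_mult_mat_vec)
  have "poly g (?x i) = 0" if i: "i < n" for i
  proof (cases "i = 0 \<or> i = n - 1")
    case False
    then have p: "p \<ge> 1" and i': "i \<in> {1..<n - 1}"
      using i n by auto
    define r where "r = (\<Prod>j\<in>{1..<n - 1} - {i}. [:- ?x j, 1:])"
    obtain q where q: "pderiv q = r" "degree q \<le> Suc (degree r)"
      using ex_poly_antiderivative[of r] by blast
    \<comment> \<open>Of the p interior nodes one is omitted, so \<open>r\<close> has degree p - 1
      and its antiderivative stays within the degree p for which \<open>orth\<close> holds.\<close>
    have "degree r = card ({1..<n - 1} - {i})"
      unfolding r_def by (subst degree_prod_eq_sum_degree) auto
    then have "degree q \<le> p"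
      using q(2) i' n p by simp
    then have "0 = (\<Sum>k<n. lgl_weight n k * poly g (?x k) * poly r (?x k))"
      using orth[of q] q(1) by simp
    also have "\<dots> = (\<Sum>k<n. if k = i then lgl_weight n i * poly g (?x i) * poly r (?x i) else 0)"
    proof (rule sum.cong[OF refl])
      fix k assume "k \<in> {..<n}"
      then have "k = 0 \<or> k = n - 1 \<or> k \<in> {1..<n - 1}"
        by auto
      then show "lgl_weight n k * poly g (?x k) * poly r (?x k)
          = (if k = i then lgl_weight n i * poly g (?x i) * poly r (?x i) else 0)"
        using g0 False by (auto simp: r_def poly_prod)
    qed
    also have "\<dots> = lgl_weight n i * poly g (?x i) * poly r (?x i)"
      using i by simp
    finally have "lgl_weight n i * poly g (?x i) * poly r (?x i) = 0"
      by simp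
    moreover have "poly r (?x i) \<noteq> 0"
      using i by (auto simp: r_def poly_prod lgl_node_eq_iff[OF n2])
    ultimately show ?thesis
      using lgl_weight_pos[OF n2 i] by auto
  qed (use g0 in auto)
  then show "nodal_values n f = nodal_values n [:c:]"
    by (intro eq_vecI) (auto simp: g_def)
qed

text \<open>A polynomial known to represent the image under \<open>D\<close> is integrated, and the
  difference to \<open>f\<close> lies in the kernel of \<open>D\<close>, hence is constant at the
  nodes. The disjunct \<open>q = 0\<close> covers \<open>k = 0\<close>, as the zero polynomial has
  degree 0.\<close>

lemma sbp_operator_power_kernel:
  assumes n: "n = p + 2" and D: "sbp_operator n p D"
  shows "k \<le> p + 1 \<Longrightarrow> (D ^\<^sub>m k) *\<^sub>v nodal_values n f = 0\<^sub>v n \<Longrightarrow>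
    \<exists>q. (q = 0 \<or> degree q < k) \<and> nodal_values n f = nodal_values n q"
proof (induction k arbitrary: f)
  case 0
  have "dim_row D = n"
    using sbp_operator_carrier[OF D] by simp
  then have "nodal_values n f = nodal_values n 0"
    using 0 one_mult_mat_vec[of "nodal_values n f" n] by (auto simp: nodal_values_def)
  then show ?case
    by blast
next
  case (Suc k)
  note Dc = sbp_operator_carrier[OF D]
  have n2: "n \<ge> 2"
    using n by simp
  obtain g where g: "D *\<^sub>v nodal_values n f = nodal_values n g"
    using nodal_values_surj[OF n2, of "D *\<^sub>v nodal_values n f"] Dc by auto
  \<comment> \<open>\<open>D ^\<^sub>m Suc k\<close> unfolds to \<open>D ^\<^sub>m k * D\<close>, so
    one factor \<open>D\<close> acts first.\<close>
  have "(D ^\<^sub>m k) *\<^sub>v nodal_values n g = 0\<^sub>v n"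
    using Suc.prems(2) assoc_mult_mat_vec[of "D ^\<^sub>m k" n n D n "nodal_values n f"] Dc g by simp
  then obtain q where q: "q = 0 \<or> degree q < k" "nodal_values n g = nodal_values n q"
    using Suc by auto
  obtain r where r: "pderiv r = q" "degree r \<le> Suc (degree q)" "q = 0 \<Longrightarrow> r = 0"
    using ex_poly_antiderivative by blast
  \<comment> \<open>Since \<open>Suc k \<le> p + 1\<close>, this gives degree at most
    \<open>p\<close>, where \<open>D\<close> differentiates \<open>r\<close> exactly.\<close>
  have dr: "degree r \<le> k"
    using q(1) r(2,3) by auto
  have "D *\<^sub>v nodal_values n (f - r) = 0\<^sub>v n"
    using g q(2) sbp_operator_exact[OF D, of r] dr Suc.prems(1)
    by (simp add: mult_nodal_values_diff[OF Dc] r(1))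
  then obtain c where c: "nodal_values n (f - r) = nodal_values n [:c:]"
    using sbp_operator_kernel[OF n D] by blast
  have "nodal_values n f = nodal_values n (r + [:c:])"
  proof (rule eq_vecI)
    fix i assume "i < dim_vec (nodal_values n (r + [:c:]))"
    then show "nodal_values n f $ i = nodal_values n (r + [:c:]) $ i"
      using arg_cong[OF c, of "\<lambda>v. v $ i"] by simp
  qed simp
  moreover have "degree (r + [:c:]) < Suc k"
    using degree_add_le[OF dr, of "[:c:]"] by simp
  ultimately show ?case
    by blast
qed

text \<open>Otherwise x^(p+1) would agree at all p + 2 nodes with a polynomial of degree at most p,
  hence be equal to it.\<close>

lemma sbp_operator_power_nonzero:
  assumes n: "n = p + 2" and D: "sbp_operator n p D"
  shows "D ^\<^sub>m (p + 1) \<noteq> 0\<^sub>m n n"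
proof
  let ?f = "Polynomial.monom (1 :: real) (p + 1)"
  assume "D ^\<^sub>m (p + 1) = 0\<^sub>m n n"
  then have "(D ^\<^sub>m (p + 1)) *\<^sub>v nodal_values n ?f = 0\<^sub>v n"
    by (simp only:) (intro eq_vecI; simp)
  then obtain q where q: "q = 0 \<or> degree q < p + 1" "nodal_values n ?f = nodal_values n q"
    using sbp_operator_power_kernel[OF n D le_refl] by blast
  have "?f = q"
  proof (rule poly_eq_if_eq_at_lgl_nodes[of n])
    show "poly ?f (lgl_node n i) = poly q (lgl_node n i)" if "i < n" for i
      using arg_cong[OF q(2), of "\<lambda>v. v $ i"] that by simp
  qed (use n q(1) in \<open>auto simp: degree_monom_eq\<close>)
  then show False
    using q(1) by (auto simp: degree_monom_eq monom_eq_0_iff)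
qed

text \<open>Up to degree \<open>p\<close> each factor \<open>D\<close> differentiates exactly, and
  more than \<open>degree q\<close> derivatives give zero.\<close>

lemma sbp_operator_power_annihilates:
  assumes D: "sbp_operator n p D"
  shows "degree q \<le> p \<Longrightarrow> degree q < k \<Longrightarrow> (D ^\<^sub>m k) *\<^sub>v nodal_values n q = 0\<^sub>v n"
proof (induction k arbitrary: q)
  case (Suc k)
  note Dc = sbp_operator_carrier[OF D]
  have pow: "D ^\<^sub>m k \<in> carrier_mat n n"
    using Dc by simp
  have "(D ^\<^sub>m Suc k) *\<^sub>v nodal_values n q = (D ^\<^sub>m k) *\<^sub>v nodal_values n (pderiv q)"
    using assoc_mult_mat_vec[OF pow Dc nodal_values_carrier] sbp_operator_exact[OF D Suc.prems(1)] by simp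
  also have "\<dots> = 0\<^sub>v n"
  proof (cases "degree q = 0")
    case True
    then have "pderiv q = 0"
      by (simp add: pderiv_eq_0_iff)
    then have "nodal_values n (pderiv q) = 0\<^sub>v n"
      by (auto simp: nodal_values_def)
    then show ?thesis
      using pow by (intro eq_vecI) (auto simp: scalar_prod_def)
  next
    case False
    then show ?thesis
      using Suc.prems by (intro Suc.IH) (auto simp: degree_pderiv)
  qed
  finally show ?case .
qed simp

section \<open>Comparison of the two dissipation matrices\<close>

theorem theorem1:
  fixes p n s :: nat and \<A> :: "real \<Rightarrow> real" and D Ds :: "real mat"
  assumes "n = p + 2" and "n \<ge> 2" and "s = p + 1"
    and "\<And>x. x \<in> {-1..1} \<Longrightarrow> \<A> x > 0"
    and "sbp_operator n p D"
    and "sth_derivative_operator n p D s Ds"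
  shows "\<exists>\<alpha>::real. \<alpha> > 0 \<and>
           derivative_dissipation n \<A> Ds = \<alpha> \<cdot>\<^sub>m projection_dissipation n p \<A>"
proof -
  note n = \<open>n = p + 2\<close> and D = \<open>sbp_operator n p D\<close>
  have "Ds \<in> carrier_mat n n \<and> Ds \<noteq> 0\<^sub>m n n \<and>
      (\<forall>q. degree q \<le> p \<longrightarrow> Ds *\<^sub>v nodal_values n q = 0\<^sub>v n)"
    using assms(6) unfolding sth_derivative_operator_def
  \<comment> \<open>A direct discretization has these properties by definition, so only the power of
    \<open>D\<close> is treated.\<close>
  proof (elim disjE)
    assume "Ds = D ^\<^sub>m s"
    then have Ds: "Ds = D ^\<^sub>m (p + 1)"
      using \<open>s = p + 1\<close> by simp
    show ?thesis
      unfolding Ds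
      using pow_carrier_mat[OF sbp_operator_carrier[OF D]] sbp_operator_power_nonzero[OF n D]
        sbp_operator_power_annihilates[OF D, of _ "p + 1"] by (simp del: pow_mat.simps)
  qed
  then have Ds: "Ds \<in> carrier_mat n n" "Ds \<noteq> 0\<^sub>m n n"
    "\<And>q. degree q \<le> p \<Longrightarrow> Ds *\<^sub>v nodal_values n q = 0\<^sub>v n"
    by blast+
  \<comment> \<open>The common factor c c^T, depending only on \<open>n\<close> and
    \<open>p\<close>.\<close>
  define C where "C = mat n n (\<lambda>(j, k).
    Polynomial.coeff (lagrange_basis n j) (p + 1) * Polynomial.coeff (lagrange_basis n k) (p + 1))"
  obtain \<beta> where \<beta>: "\<beta> > 0" "derivative_dissipation n \<A> Ds = \<beta> \<cdot>\<^sub>m C"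
    using derivative_dissipation_rank_one[where \<A> = \<A>, OF n Ds assms(4)] unfolding C_def by blast
  obtain \<gamma> where \<gamma>: "\<gamma> > 0" "derivative_dissipation n \<A> (P_mat n p) = \<gamma> \<cdot>\<^sub>m C"
    using derivative_dissipation_rank_one[where \<A> = \<A>, OF n P_mat_carrier P_mat_nonzero[OF n]
        P_mat_annihilates[OF n] assms(4)] unfolding C_def by blast
  \<comment> \<open>Both dissipation matrices are the same expression, taken at
    \<open>P_mat n p\<close> and at \<open>Ds\<close>.\<close>
  have "projection_dissipation n p \<A> = \<gamma> \<cdot>\<^sub>m C"
    using \<gamma>(2) by (simp add: projection_dissipation_def derivative_dissipation_def)
  then have "derivative_dissipation n \<A> Ds = (\<beta> / \<gamma>) \<cdot>\<^sub>m projection_dissipation n p \<A>"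
    using \<beta>(2) \<gamma>(1) by (intro eq_matI) auto
  then show ?thesis
    using \<beta>(1) \<gamma>(1) by (intro exI[of _ "\<beta> / \<gamma>"]) simp
qed

end
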